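(* Let $(X,d^*,f)$ be a discrete dynamical system and let $d$ be a metric on $X$ such that $(X,d^* )$ is an ultracontinuum of $(X,d)$. If $(X,d^*,f)$ is chaotic and $f$ is continuous on $(X,d)$, then $(X,d,f)$ is chaotic.
   Context: A discrete dynamical system $(X,d,f)$ consists of a set $X$, a metric $d$ on $X$, and a function $f:X\to X$ (not assumed continuous). A continuum is a compact, connected metric space with uncountably many elements. $(X,d^* )$ is an ultracontinuum of $(X,d)$ if and only if $(X,d)$ is a continuum and the metric topology of $(X,d^* )$ is strictly finer than the metric topology of $(X,d)$. $(X,d,f)$ is topologically transitive if and only if for every pair of nonempty open sets $U,V$ of $(X,d)$ there is an integer $n\ge 0$ with $f^n(U)\cap V\ne\emptyset$. It is sensitive if and only if there is a real $\epsilon>0$ such that for every $x\in X$ and every $\delta>0$ there exist $y\in X$ and a positive integer $n$ with $d(x,y)<\delta$ and $d(f^n(x),f^n(y))>\epsilon$. It has dense periodic orbits if and only if every nonempty open set $U$ of $(X,d)$ contains an element $x$ with $f^n(x)=x$ for some positive integer $n$. It is chaotic (Devaney chaotic) if and only if it is topologically transitive, sensitive, and has dense periodic orbits. *)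

theory Defs
  imports "HOL-Analysis.Analysis"
begin

text \<open>Metric spaces are given by a carrier set and a distance function, as in the locale
  \<^locale>\<open>Metric_space\<close>. The self-map of a dynamical system is a total HOL function of which only
  the restriction to the carrier matters; no continuity is required.\<close>

definition dynamical_system :: "'a set \<Rightarrow> ('a \<Rightarrow> 'a \<Rightarrow> real) \<Rightarrow> ('a \<Rightarrow> 'a) \<Rightarrow> bool" where
  "dynamical_system X d f \<longleftrightarrow> Metric_space X d \<and> f ` X \<subseteq> X"

definition continuum :: "'a set \<Rightarrow> ('a \<Rightarrow> 'a \<Rightarrow> real) \<Rightarrow> bool" where
  "continuum X d \<longleftrightarrow>
     Metric_space X d \<and>
     compact_space (Metric_space.mtopology X d) \<and>
     connected_space (Metric_space.mtopology X d) \<and>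
     uncountable X"

definition strictly_finer :: "'a topology \<Rightarrow> 'a topology \<Rightarrow> bool" where
  "strictly_finer S T \<longleftrightarrow> {U. openin T U} \<subset> {U. openin S U}"

text \<open>In \<open>ultracontinuum X d' d\<close>, the space with metric \<open>d'\<close> is an ultracontinuum of the
  continuum with metric \<open>d\<close>.\<close>

definition ultracontinuum ::
  "'a set \<Rightarrow> ('a \<Rightarrow> 'a \<Rightarrow> real) \<Rightarrow> ('a \<Rightarrow> 'a \<Rightarrow> real) \<Rightarrow> bool" where
  "ultracontinuum X d' d \<longleftrightarrow>
     Metric_space X d' \<and> continuum X d \<and>
     strictly_finer (Metric_space.mtopology X d') (Metric_space.mtopology X d)"

definition topologically_transitive ::
  "'a set \<Rightarrow> ('a \<Rightarrow> 'a \<Rightarrow> real) \<Rightarrow> ('a \<Rightarrow> 'a) \<Rightarrow> bool" where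
  "topologically_transitive X d f \<longleftrightarrow>
     (\<forall>U V. openin (Metric_space.mtopology X d) U \<and> U \<noteq> {} \<and>
            openin (Metric_space.mtopology X d) V \<and> V \<noteq> {} \<longrightarrow>
        (\<exists>n::nat. (f ^^ n) ` U \<inter> V \<noteq> {}))"

definition sensitive ::
  "'a set \<Rightarrow> ('a \<Rightarrow> 'a \<Rightarrow> real) \<Rightarrow> ('a \<Rightarrow> 'a) \<Rightarrow> bool" where
  "sensitive X d f \<longleftrightarrow>
     (\<exists>\<epsilon>>0. \<forall>x\<in>X. \<forall>\<delta>>0. \<exists>y\<in>X. \<exists>n::nat. n > 0 \<and>
        d x y < \<delta> \<and> d ((f ^^ n) x) ((f ^^ n) y) > \<epsilon>)"

definition dense_periodic_orbits ::
  "'a set \<Rightarrow> ('a \<Rightarrow> 'a \<Rightarrow> real) \<Rightarrow> ('a \<Rightarrow> 'a) \<Rightarrow> bool" where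
  "dense_periodic_orbits X d f \<longleftrightarrow>
     (\<forall>U. openin (Metric_space.mtopology X d) U \<and> U \<noteq> {} \<longrightarrow>
        (\<exists>x\<in>U. \<exists>n::nat. n > 0 \<and> (f ^^ n) x = x))"

definition chaotic ::
  "'a set \<Rightarrow> ('a \<Rightarrow> 'a \<Rightarrow> real) \<Rightarrow> ('a \<Rightarrow> 'a) \<Rightarrow> bool" where
  "chaotic X d f \<longleftrightarrow>
     topologically_transitive X d f \<and> sensitive X d f \<and> dense_periodic_orbits X d f"

end

theory Submission
  imports Defs
begin

text \<open>Transitivity and density of periodic points pass to any coarser topology. Sensitivity does
  not, but for a continuous map on an infinite metric space it follows from the other two
  properties, by the argument of Banks, Brooks, Cairns, Davis and Stacey: there are two disjoint
  periodic orbits, at distance at least \<open>8 * e\<close> from each other, so every \<open>x\<close> is at distance at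
  least \<open>4 * e\<close> from one of them. Arbitrarily close to \<open>x\<close> there are a periodic point \<open>p\<close>, which
  keeps returning to the neighbourhood of \<open>x\<close>, and by transitivity a point \<open>y\<close> which follows the
  distant orbit for a full period of \<open>p\<close>. At a common multiple of that period the images of \<open>p\<close>
  and \<open>y\<close> are more than \<open>2 * e\<close> apart, so one of them is more than \<open>e\<close> away from the image
  of \<open>x\<close>.\<close>

lemma topologically_transitive_coarser:
  assumes "topologically_transitive X d' f"
    and "\<And>U. openin (Metric_space.mtopology X d) U \<Longrightarrow> openin (Metric_space.mtopology X d') U"
  shows "topologically_transitive X d f"
  using assms unfolding topologically_transitive_def by blast

lemma dense_periodic_orbits_coarser:
  assumes "dense_periodic_orbits X d' f"
    and "\<And>U. openin (Metric_space.mtopology X d) U \<Longrightarrow> openin (Metric_space.mtopology X d') U"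
  shows "dense_periodic_orbits X d f"
  using assms unfolding dense_periodic_orbits_def by blast

lemma continuous_map_funpow:
  assumes "continuous_map T T f"
  shows "continuous_map T T (f ^^ n)"
proof (induction n)
  case 0
  show ?case by (simp add: id_def)
next
  case (Suc n)
  then have "continuous_map T T (f \<circ> f ^^ n)" using assms by (rule continuous_map_compose)
  then show ?case by (simp only: funpow.simps)
qed

lemma finite_periodic_orbit:
  assumes "n > 0" "(f ^^ n) q = q"
  shows "finite (range (\<lambda>i. (f ^^ i) q))"
proof (rule finite_surj)
  show "finite {..<n}" by simp
  show "range (\<lambda>i. (f ^^ i) q) \<subseteq> (\<lambda>i. (f ^^ i) q) ` {..<n}"
  proof clarify
    fix i
    have "(f ^^ i) q = (f ^^ (i mod n)) q"
      using funpow_mod_eq[OF assms(2)] by simp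
    then show "(f ^^ i) q \<in> (\<lambda>i. (f ^^ i) q) ` {..<n}"
      using assms(1) by auto
  qed
qed

lemma funpow_periodic_mult:
  assumes "(f ^^ n) p = p"
  shows "(f ^^ (n * j)) p = p"
  using funpow_mod_eq[OF assms, of "n * j"] by simp

text \<open>From a common point, following the orbit of \<open>q\<close> on to a multiple of its
  period leads back to \<open>q\<close>, which would then lie on the forward orbit of
  \<open>p\<close>.\<close>

lemma periodic_orbits_disjoint:
  assumes "n > 0" "(f ^^ n) q = q" "q \<notin> range (\<lambda>i. (f ^^ i) p)"
  shows "range (\<lambda>i. (f ^^ i) p) \<inter> range (\<lambda>i. (f ^^ i) q) = {}"
proof (rule ccontr)
  assume "\<not> ?thesis"
  then obtain i j where ij: "(f ^^ i) p = (f ^^ j) q" by auto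
  \<comment> \<open>\<open>n * j\<close> is a multiple of the period that is at least
    \<open>j\<close>, so \<open>n * j - j\<close> is a true difference.\<close>
  have "j \<le> n * j" using assms(1) by simp
  then have "(f ^^ (n * j)) q = (f ^^ (n * j - j)) ((f ^^ j) q)"
    by (metis comp_apply funpow_add le_add_diff_inverse2)
  also have "\<dots> = (f ^^ (n * j - j + i)) p"
    by (simp add: ij funpow_add)
  finally show False
    using assms(3) funpow_periodic_mult[OF assms(2)] by (metis rangeI)
qed

context Metric_space
begin

lemma finite_disjoint_separated:
  assumes "finite A" "finite B" "A \<subseteq> M" "B \<subseteq> M" "A \<inter> B = {}"
  obtains r where "r > 0" "\<And>a b. a \<in> A \<Longrightarrow> b \<in> B \<Longrightarrow> r \<le> d a b"
proof
  \<comment> \<open>The extra element 1 keeps \<open>Min\<close> meaningful when \<open>A\<close> or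
    \<open>B\<close> is empty.\<close>
  let ?D = "insert 1 ((\<lambda>(a, b). d a b) ` (A \<times> B))"
  have fin: "finite ?D" using assms by simp
  have "\<forall>t\<in>?D. t > 0" using assms by (auto intro!: mdist_pos_less)
  then show "Min ?D > 0" using fin by (subst Min_gr_iff) auto
  show "Min ?D \<le> d a b" if "a \<in> A" "b \<in> B" for a b
    using that fin by (intro Min_le) auto
qed

lemma sensitive_if_transitive_dense_periodic:
  assumes inf: "infinite M"
    and cont: "continuous_map mtopology mtopology f"
    and trans: "topologically_transitive M d f"
    and dense: "dense_periodic_orbits M d f"
  shows "sensitive M d f"
proof -
  have contn: "continuous_map mtopology mtopology (f ^^ n)" for n
    by (rule continuous_map_funpow[OF cont])
  have fM: "(f ^^ n) x \<in> M" if "x \<in> M" for n x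
    using contn[of n] that by (auto simp: continuous_map_def)
  have periodic: "\<exists>x\<in>U. \<exists>n>0. (f ^^ n) x = x" if "openin mtopology U" "U \<noteq> {}" for U
    using dense that unfolding dense_periodic_orbits_def by blast
  define orb where "orb q = range (\<lambda>i. (f ^^ i) q)" for q
  have "M \<noteq> {}" using inf by auto
  then obtain q1 n1 where q1: "q1 \<in> M" "n1 > 0" "(f ^^ n1) q1 = q1"
    using periodic[of M] openin_topspace[of mtopology] by auto
  have fin1: "finite (orb q1)"
    unfolding orb_def using finite_periodic_orbit q1 by metis
  have orb1: "orb q1 \<subseteq> M" using fM q1 by (auto simp: orb_def)
  \<comment> \<open>The complement of a finite orbit is open, and nonempty as \<open>M\<close> is
    infinite, so it contains a second periodic point.\<close>
  have "closedin mtopology (orb q1)"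
    using fin1 orb1 Hausdorff_space_mtopology by (intro closedin_Hausdorff_finite) auto
  then have "openin mtopology (M - orb q1)"
    using openin_diff[OF openin_topspace, of mtopology] by simp
  moreover have "M - orb q1 \<noteq> {}" using inf fin1 by (metis finite_subset Diff_eq_empty_iff)
  ultimately obtain q2 n2 where q2: "q2 \<in> M - orb q1" "n2 > 0" "(f ^^ n2) q2 = q2"
    using periodic by blast
  have fin2: "finite (orb q2)"
    unfolding orb_def using finite_periodic_orbit q2 by metis
  have orb2: "orb q2 \<subseteq> M" using fM q2 by (auto simp: orb_def)
  have "orb q1 \<inter> orb q2 = {}"
    using periodic_orbits_disjoint[OF q2(2,3)] q2(1) by (simp add: orb_def)
  then obtain r where r: "r > 0" "\<And>a b. a \<in> orb q1 \<Longrightarrow> b \<in> orb q2 \<Longrightarrow> r \<le> d a b"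
    using finite_disjoint_separated[OF fin1 fin2 orb1 orb2] by blast
  define e where "e = r / 8"
  have e: "e > 0" "r = 8 * e" using r by (auto simp: e_def)
  have far: "\<exists>q\<in>M. \<forall>i. d x ((f ^^ i) q) \<ge> 4 * e" if x: "x \<in> M" for x
  proof (rule ccontr)
    assume "\<not> ?thesis"
    then obtain i j where "d x ((f ^^ i) q1) < 4 * e" "d x ((f ^^ j) q2) < 4 * e"
      using q1 q2 by (meson DiffD1 not_le)
    moreover have "r \<le> d ((f ^^ i) q1) ((f ^^ j) q2)" by (rule r) (auto simp: orb_def)
    moreover have "d ((f ^^ i) q1) ((f ^^ j) q2) \<le> d x ((f ^^ i) q1) + d x ((f ^^ j) q2)"
      using triangle''[of "(f ^^ i) q1" x "(f ^^ j) q2"] fM x q1(1) q2(1) by simp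
    ultimately show False using e by linarith
  qed
  show ?thesis
    unfolding sensitive_def
  proof (intro exI[of _ e] conjI ballI allI impI e(1))
    fix x and \<delta> :: real
    assume x: "x \<in> M" and "\<delta> > 0"
    \<comment> \<open>The bound \<open>\<delta>\<close> makes points of \<open>U\<close> admissible
      witnesses; the bound \<open>e\<close> serves the final estimate.\<close>
    define U where "U = mball x (min \<delta> e)"
    have U: "openin mtopology U" "x \<in> U"
      using x \<open>\<delta> > 0\<close> e by (auto simp: U_def)
    obtain p n where p: "p \<in> U" "n > 0" "(f ^^ n) p = p"
      using periodic U by blast
    obtain q where q: "q \<in> M" "\<And>i. d x ((f ^^ i) q) \<ge> 4 * e"
      using far[OF x] by blast
    \<comment> \<open>Points whose iterates up to time \<open>n\<close> stay within \<open>e\<close>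
      of those of \<open>q\<close>; a finite intersection of preimages of balls, hence open.\<close>
    define V where
      "V = (\<Inter>i\<in>{..n}. {z \<in> topspace mtopology. (f ^^ i) z \<in> mball ((f ^^ i) q) e})"
    have "openin mtopology V"
      unfolding V_def
      by (intro openin_INT2 openin_continuous_map_preimage[OF contn]) auto
    moreover have "q \<in> V" using q fM e by (auto simp: V_def)
    ultimately obtain y k where y: "y \<in> U" "(f ^^ k) y \<in> V"
      using trans U unfolding topologically_transitive_def by blast
    \<comment> \<open>The first multiple of \<open>n\<close> beyond \<open>k\<close>:
      \<open>p\<close> has returned, and \<open>m - k\<close> lies in the range controlled by
      \<open>V\<close>.\<close>
    define m where "m = n * (k div n + 1)"
    have m: "m > 0" "k \<le> m" "m - k \<le> n"
    proof -
      have "m = k - k mod n + n" by (simp add: m_def minus_mod_eq_mult_div)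
      moreover have "k mod n < n" "k mod n \<le> k" using p by auto
      ultimately show "m > 0" "k \<le> m" "m - k \<le> n" by linarith+
    qed
    have "(f ^^ m) y = (f ^^ (m - k)) ((f ^^ k) y)"
      using m(2) by (metis comp_apply funpow_add le_add_diff_inverse2)
    then have qy: "d ((f ^^ (m - k)) q) ((f ^^ m) y) < e"
      using y(2) m(3) by (auto simp: V_def)
    have pm: "(f ^^ m) p = p" unfolding m_def by (rule funpow_periodic_mult[OF p(3)])
    have mem: "p \<in> M" "y \<in> M" and dist: "d x p < e" "d x p < \<delta>" "d x y < \<delta>"
      using p(1) y(1) by (auto simp: U_def)
    \<comment> \<open>The left side is at least \<open>4 * e\<close> and the outer two terms on the
      right are below \<open>e\<close>, so the middle one exceeds \<open>2 * e\<close>.\<close>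
    have "d x ((f ^^ (m - k)) q) \<le> d x p + d p ((f ^^ m) y) + d ((f ^^ (m - k)) q) ((f ^^ m) y)"
      using triangle[of x p "(f ^^ (m - k)) q"]
        triangle'[of p "(f ^^ m) y" "(f ^^ (m - k)) q"] x mem fM q(1) by fastforce
    moreover have "d p ((f ^^ m) y) \<le> d ((f ^^ m) x) ((f ^^ m) p) + d ((f ^^ m) x) ((f ^^ m) y)"
      using triangle''[of p "(f ^^ m) x" "(f ^^ m) y"] x mem fM pm by simp
    ultimately have "d ((f ^^ m) x) ((f ^^ m) p) > e \<or> d ((f ^^ m) x) ((f ^^ m) y) > e"
      using q(2)[of "m - k"] qy dist(1) by linarith
    then show "\<exists>y\<in>M. \<exists>n. n > 0 \<and> d x y < \<delta> \<and> d ((f ^^ n) x) ((f ^^ n) y) > e"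
      using mem dist m(1) by blast
  qed
qed

end

theorem lemma4:
  fixes X :: "'a set" and d dstar :: "'a \<Rightarrow> 'a \<Rightarrow> real" and f :: "'a \<Rightarrow> 'a"
  assumes "dynamical_system X dstar f"
    and "Metric_space X d"
    and "ultracontinuum X dstar d"
    and "chaotic X dstar f"
    and "continuous_map (Metric_space.mtopology X d) (Metric_space.mtopology X d) f"
  shows "chaotic X d f"
proof -
  have finer: "openin (Metric_space.mtopology X dstar) U"
    if "openin (Metric_space.mtopology X d) U" for U
    using assms(3) that unfolding ultracontinuum_def strictly_finer_def by blast
  \<comment> \<open>A continuum is uncountable by definition.\<close>
  have "infinite X"
    using assms(3) countable_finite unfolding ultracontinuum_def continuum_def by blast
  have chaos: "topologically_transitive X dstar f" "dense_periodic_orbits X dstar f"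
    using assms(4) by (simp_all add: chaotic_def)
  have trans: "topologically_transitive X d f"
    using chaos(1) finer by (rule topologically_transitive_coarser)
  have dense: "dense_periodic_orbits X d f"
    using chaos(2) finer by (rule dense_periodic_orbits_coarser)
  have "sensitive X d f"
    using \<open>infinite X\<close> assms(5) trans dense
    by (rule Metric_space.sensitive_if_transitive_dense_periodic[OF assms(2)])
  with trans dense show ?thesis by (simp add: chaotic_def)
qed

end
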